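(* Let $G=(V,E,F)$ be a connected graph of genus $g$ combinatorially embedded on an orientable surface, let $c:\vec E\to\mathbb R$ be a dart cost function, and let $c':\vec E\to\mathbb R\times\mathbb Z^{2g+2}$ be its holiest perturbation. Let $\mu:\vec E\to\mathbb R^+$ be a dart capacity function and $b:V\to\mathbb R$ a vertex demand function. Then the minimum-cost feasible flow with respect to $c'$, $\mu$, $b$ (when one exists) is unique, and it is also a minimum-cost feasible flow with respect to $c$, $\mu$, $b$.
   Context: Combinatorial embedding: a finite dart set $\vec E$, a fixed-point-free involution $\mathrm{rev}$ whose orbits are the edges $E$ (each edge $e$ has a designated canonical dart $\vec e$), a permutation $\pi$ whose orbits are the vertices (each orbit lists the darts directed into a vertex, its head; the tail of a dart is the head of its reversal); faces $F$ are the orbits of $\mathrm{rev}\circ\pi$. The genus $g$ satisfies $|V|-|E|+|F|=2-2g$. In the dual graph $G^*$ (vertex set $F$), dart $d$ is a dual dart from the face containing $\mathrm{rev}(d)$ to the face containing $d$. A tree-cotree decomposition is a partition $E=T\sqcup L\sqcup C$ with $T$ a spanning tree of $G$, $C$ a spanning tree of $G^*$, $|L|=2g$. Let $\gamma_1,\dots,\gamma_{2g}$ be the fundamental cycles in $G^*$ of the edges of $L$ with respect to $C$, each oriented arbitrarily. The homology signature $[e]\in\mathbb Z^{2g}$ of edge $e$ has $[e]_i=1$ if $\vec e\in\gamma_i$, $-1$ if $\mathrm{rev}(\vec e)\in\gamma_i$, $0$ otherwise; $[d]=[e]$ if $d=\vec e$ and $[d]=-[e]$ otherwise. A dual flow is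 $z:\vec E\to\mathbb R$ with $z(\mathrm{rev}(d))=-z(d)$; a drainage with sink $r\in F$ is a dual flow whose dual imbalance (sum of $z$ over dual darts entering the face) is negative at every face other than $r$. The holiest perturbation of $c$ (with respect to some tree-cotree decomposition and some drainage $z$) is $c'(d)=(c(d),1,[d]_1,\dots,[d]_{2g},z(d))$. For a flow $f:\vec E\to\mathbb R$, $c'(f)=\sum_d f(d)c'(d)$ and $c(f)=\sum_d f(d)c(d)$; vector costs are compared lexicographically. The imbalance of $f$ is $\delta f(v)=\sum_{\text{head}(d)=v}f(d)-\sum_{\text{tail}(d)=v}f(d)$; $f$ is feasible w.r.t. $\mu,b$ if $0\le f(d)\le\mu(d)$ for all darts and $\delta f=b$. A minimum-cost feasible flow is a feasible flow of minimum cost. *)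

theory Defs
  imports
    Complex_Main
    "HOL-Combinatorics.Orbits"
    "HOL-Library.List_Lexorder"
    "Graph_Theory.Graph_Theory"
begin

text \<open>The dart set is a finite type, so flows and costs are plain functions on it.\<close>

record 'd embedding =
  reversal :: "'d \<Rightarrow> 'd"
  rotation :: "'d \<Rightarrow> 'd"
  canonical :: "'d set \<Rightarrow> 'd"

abbreviation edge_of :: "'d embedding \<Rightarrow> 'd \<Rightarrow> 'd set" where
  "edge_of M d \<equiv> orbit (reversal M) d"

definition edges :: "'d embedding \<Rightarrow> 'd set set" where
  "edges M = range (edge_of M)"

text \<open>A vertex is the set of darts directed into it.\<close>

definition primal :: "'d embedding \<Rightarrow> ('d set, 'd) pre_digraph" where
  "primal M = \<lparr> verts = range (orbit (rotation M)), arcs = UNIV,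
     tail = (\<lambda>d. orbit (rotation M) (reversal M d)),
     head = (\<lambda>d. orbit (rotation M) d) \<rparr>"

definition dual :: "'d embedding \<Rightarrow> ('d set, 'd) pre_digraph" where
  "dual M = \<lparr> verts = range (orbit (reversal M \<circ> rotation M)), arcs = UNIV,
     tail = (\<lambda>d. orbit (reversal M \<circ> rotation M) (reversal M d)),
     head = (\<lambda>d. orbit (reversal M \<circ> rotation M) d) \<rparr>"

locale combinatorial_embedding =
  fixes M :: "'d::finite embedding"
  assumes reversal_involution: "reversal M (reversal M d) = d"
    and reversal_fixpoint_free: "reversal M d \<noteq> d"
    and rotation_permutes: "rotation M permutes UNIV"
    and canonical_in_edge: "e \<in> edges M \<Longrightarrow> canonical M e \<in> e"

definition has_genus :: "'d embedding \<Rightarrow> nat \<Rightarrow> bool" where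
  "has_genus M g \<longleftrightarrow>
     int (card (verts (primal M))) - int (card (edges M)) + int (card (verts (dual M)))
       = 2 - 2 * int g"

text \<open>In what follows \<open>H\<close> is \<open>primal M\<close> or \<open>dual M\<close>.
  Restricting to an edge set keeps all vertices and both darts of every edge.\<close>

definition restrict_edges ::
  "('d set, 'd) pre_digraph \<Rightarrow> 'd set set \<Rightarrow> ('d set, 'd) pre_digraph" where
  "restrict_edges H S = H\<lparr>arcs := \<Union>S\<rparr>"

text \<open>The library's \<open>cycle\<close> is a directed one and admits \<open>[d, reversal M d]\<close>.
  Cycles of the underlying undirected graph must moreover use every edge at most once. For the
  same reason the library's \<open>forest\<close> and \<open>spanning_tree\<close> do not apply to
  these symmetric digraphs.\<close>

definition undirected_cycle ::
  "'d embedding \<Rightarrow> ('d set, 'd) pre_digraph \<Rightarrow> 'd list \<Rightarrow> bool" where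
  "undirected_cycle M H p \<longleftrightarrow> pre_digraph.cycle H p \<and> distinct (map (edge_of M) p)"

definition is_spanning_tree ::
  "'d embedding \<Rightarrow> ('d set, 'd) pre_digraph \<Rightarrow> 'd set set \<Rightarrow> bool" where
  "is_spanning_tree M H S \<longleftrightarrow>
     S \<subseteq> edges M \<and>
     Digraph_Component.connected (restrict_edges H S) \<and>
     (\<nexists>p. undirected_cycle M (restrict_edges H S) p)"

definition tree_cotree_decomposition ::
  "'d embedding \<Rightarrow> nat \<Rightarrow> 'd set set \<Rightarrow> 'd set set \<Rightarrow> 'd set set \<Rightarrow> bool" where
  "tree_cotree_decomposition M g T L C \<longleftrightarrow>
     edges M = T \<union> L \<union> C \<and> T \<inter> L = {} \<and> T \<inter> C = {} \<and> L \<inter> C = {} \<and>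
     is_spanning_tree M (primal M) T \<and>
     is_spanning_tree M (dual M) C \<and>
     card L = 2 * g"

text \<open>As a dart list, the fundamental cycle is unique only up to orientation and the choice of its
  first dart; every such list is admitted.\<close>

definition is_fundamental_cycle ::
  "'d embedding \<Rightarrow> ('d set, 'd) pre_digraph \<Rightarrow> 'd set set \<Rightarrow> 'd set \<Rightarrow> 'd list \<Rightarrow> bool" where
  "is_fundamental_cycle M H S e p \<longleftrightarrow>
     undirected_cycle M (restrict_edges H (insert e S)) p \<and> e \<in> edge_of M ` set p"

definition edge_signature ::
  "'d embedding \<Rightarrow> (nat \<Rightarrow> 'd list) \<Rightarrow> 'd set \<Rightarrow> nat \<Rightarrow> int" where
  "edge_signature M \<gamma> e i =
     (if canonical M e \<in> set (\<gamma> i) then 1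
      else if reversal M (canonical M e) \<in> set (\<gamma> i) then -1
      else 0)"

definition dart_signature ::
  "'d embedding \<Rightarrow> (nat \<Rightarrow> 'd list) \<Rightarrow> 'd \<Rightarrow> nat \<Rightarrow> int" where
  "dart_signature M \<gamma> d i =
     (if d = canonical M (edge_of M d) then edge_signature M \<gamma> (edge_of M d) i
      else - edge_signature M \<gamma> (edge_of M d) i)"

definition dual_flow :: "'d embedding \<Rightarrow> ('d \<Rightarrow> real) \<Rightarrow> bool" where
  "dual_flow M z \<longleftrightarrow> (\<forall>d. z (reversal M d) = - z d)"

definition dual_imbalance :: "'d::finite embedding \<Rightarrow> ('d \<Rightarrow> real) \<Rightarrow> 'd set \<Rightarrow> real" where
  "dual_imbalance M z \<phi> = (\<Sum>d | head (dual M) d = \<phi>. z d)"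

definition drainage :: "'d::finite embedding \<Rightarrow> 'd set \<Rightarrow> ('d \<Rightarrow> real) \<Rightarrow> bool" where
  "drainage M r z \<longleftrightarrow>
     r \<in> verts (dual M) \<and> dual_flow M z \<and>
     (\<forall>\<phi> \<in> verts (dual M) - {r}. dual_imbalance M z \<phi> < 0)"

text \<open>Cost vectors are real lists of length \<open>2 * g + 3\<close>, ordered lexicographically by
  the list order of \<^theory>\<open>HOL-Library.List_Lexorder\<close>.\<close>

definition holiest_cost ::
  "'d embedding \<Rightarrow> nat \<Rightarrow> (nat \<Rightarrow> 'd list) \<Rightarrow> ('d \<Rightarrow> real) \<Rightarrow> ('d \<Rightarrow> real) \<Rightarrow> 'd \<Rightarrow> real list" where
  "holiest_cost M g \<gamma> z c d =
     [c d, 1] @ map (\<lambda>i. of_int (dart_signature M \<gamma> d i)) [1..<2 * g + 1] @ [z d]"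

definition holiest_perturbation ::
  "'d::finite embedding \<Rightarrow> nat \<Rightarrow> ('d \<Rightarrow> real) \<Rightarrow> ('d \<Rightarrow> real list) \<Rightarrow> bool" where
  "holiest_perturbation M g c c' \<longleftrightarrow>
     (\<exists>T L C l \<gamma> r z.
        tree_cotree_decomposition M g T L C \<and>
        bij_betw l {1..2 * g} L \<and>
        (\<forall>i \<in> {1..2 * g}. is_fundamental_cycle M (dual M) C (l i) (\<gamma> i)) \<and>
        drainage M r z \<and>
        c' = holiest_cost M g \<gamma> z c)"

definition flow_cost :: "('d::finite \<Rightarrow> real) \<Rightarrow> ('d \<Rightarrow> real) \<Rightarrow> real" where
  "flow_cost c f = (\<Sum>d\<in>UNIV. f d * c d)"

definition vector_flow_cost ::
  "nat \<Rightarrow> ('d::finite \<Rightarrow> real list) \<Rightarrow> ('d \<Rightarrow> real) \<Rightarrow> real list" where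
  "vector_flow_cost g c' f = map (\<lambda>k. \<Sum>d\<in>UNIV. f d * c' d ! k) [0..<2 * g + 3]"

definition imbalance :: "'d::finite embedding \<Rightarrow> ('d \<Rightarrow> real) \<Rightarrow> 'd set \<Rightarrow> real" where
  "imbalance M f v =
     (\<Sum>d | head (primal M) d = v. f d) - (\<Sum>d | tail (primal M) d = v. f d)"

definition feasible_flow ::
  "'d::finite embedding \<Rightarrow> ('d \<Rightarrow> real) \<Rightarrow> ('d set \<Rightarrow> real) \<Rightarrow> ('d \<Rightarrow> real) \<Rightarrow> bool" where
  "feasible_flow M \<mu> b f \<longleftrightarrow>
     (\<forall>d. 0 \<le> f d \<and> f d \<le> \<mu> d) \<and> (\<forall>v \<in> verts (primal M). imbalance M f v = b v)"

text \<open>Here \<open>cost\<close> is either \<open>flow_cost c\<close> or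
  \<open>vector_flow_cost g c'\<close>.\<close>

definition min_cost_feasible_flow ::
  "'d::finite embedding \<Rightarrow> (('d \<Rightarrow> real) \<Rightarrow> 'a::linorder) \<Rightarrow> ('d \<Rightarrow> real) \<Rightarrow> ('d set \<Rightarrow> real) \<Rightarrow>
    ('d \<Rightarrow> real) \<Rightarrow> bool" where
  "min_cost_feasible_flow M cost \<mu> b f \<longleftrightarrow>
     feasible_flow M \<mu> b f \<and> (\<forall>f'. feasible_flow M \<mu> b f' \<longrightarrow> cost f \<le> cost f')"

end

theory Submission
  imports Defs
begin

text \<open>
  Let \<open>h\<close> be the difference of two optimal flows. Every circulation \<open>t * h\<close> with
  \<open>0 \<le> t \<le> 1\<close> has zero cost vector, since it can be added to one optimum and subtracted from the
  other. The coordinate \<open>1\<close> then forbids \<open>h\<close> to have the same strict sign on both darts of an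
  edge. The homology coordinates make the net flow \<open>h d - h (rev d)\<close> null-homologous, so it is the
  difference of a face potential vanishing at the sink. The positive part of this potential again
  comes from some \<open>t * h\<close>, and its drainage cost is a sum of potential times imbalance over the
  faces, which is strictly negative unless the positive part vanishes; symmetrically for the
  negative part. Hence \<open>h\<close> agrees on both darts of every edge, and so it is zero.
\<close>

section \<open>Darts, edges and reversal\<close>

context combinatorial_embedding
begin

lemma edge_of_eq: "edge_of M d = {d, reversal M d}"
proof -
  have "x \<in> {d, reversal M d}" if "x \<in> edge_of M d" for x
    using that by induction (auto simp: reversal_involution)
  moreover have "reversal M d \<in> edge_of M d"
    by (rule orbit.base)
  moreover have "d \<in> edge_of M d"
    using orbit.step[OF \<open>reversal M d \<in> edge_of M d\<close>] by (simp add: reversal_involution)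
  ultimately show ?thesis by blast
qed

lemma edge_of_eq_iff: "edge_of M x = edge_of M y \<longleftrightarrow> y = x \<or> y = reversal M x"
  unfolding edge_of_eq by (auto simp: reversal_involution doubleton_eq_iff)

lemma edge_of_reversal [simp]: "edge_of M (reversal M d) = edge_of M d"
  by (simp add: edge_of_eq_iff reversal_involution)

lemma mem_Union_edges_iff:
  assumes "S \<subseteq> edges M"
  shows "d \<in> \<Union>S \<longleftrightarrow> edge_of M d \<in> S"
proof
  assume "d \<in> \<Union>S"
  then obtain x where "edge_of M x \<in> S" "d \<in> edge_of M x"
    using assms unfolding edges_def by auto
  moreover from this(2) have "edge_of M x = edge_of M d"
    by (subst edge_of_eq_iff) (simp add: edge_of_eq)
  ultimately show "edge_of M d \<in> S" by simp
qed (auto simp: edge_of_eq)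

lemma bij_reversal: "bij (reversal M)"
  by (rule involuntory_imp_bij) (rule reversal_involution)

lemma sum_reversal: "(\<Sum>d\<in>UNIV. f (reversal M d)) = (\<Sum>d\<in>UNIV. f d)"
  by (rule sum.reindex_bij_betw[OF bij_reversal])

text \<open>Reindexing by the reversal turns the second term into a copy of the first. A skew cost
  thus sees only the net flow of \<open>x\<close>.\<close>

lemma sum_skew_part:
  fixes x y :: "'d \<Rightarrow> real"
  assumes "\<And>d. y (reversal M d) = - y d"
  shows "(\<Sum>d\<in>UNIV. (x d - x (reversal M d)) * y d) = 2 * (\<Sum>d\<in>UNIV. x d * y d)"
  using sum_reversal[of "\<lambda>d. x d * y d"]
  by (simp add: assms left_diff_distrib sum_subtractf sum_negf)

end

section \<open>Walks, forests and potentials, for \<open>primal M\<close> and \<open>dual M\<close>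
  alike\<close>

locale dart_digraph = combinatorial_embedding M + wf_digraph H
  for M :: "'d::finite embedding" and H :: "('d set, 'd) pre_digraph" +
  assumes arcs_UNIV: "arcs H = UNIV"
    and tail_eq_head_reversal: "tail H d = head H (reversal M d)"
begin

lemma restrict_edges_simps [simp]:
  "verts (restrict_edges H S) = verts H" "arcs (restrict_edges H S) = \<Union>S"
  "tail (restrict_edges H S) = tail H" "head (restrict_edges H S) = head H"
  by (simp_all add: restrict_edges_def)

lemma wf_restrict_edges: "wf_digraph (restrict_edges H S)"
  by unfold_locales (simp_all add: arcs_UNIV)

lemma awalk_verts_restrict_edges [simp]:
  "pre_digraph.awalk_verts (restrict_edges H S) = awalk_verts"
proof (intro ext)
  show "pre_digraph.awalk_verts (restrict_edges H S) u p = awalk_verts u p" for u p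
    by (induction p arbitrary: u) (simp_all add: pre_digraph.awalk_verts.simps)
qed

lemma cas_restrict_edges [simp]: "pre_digraph.cas (restrict_edges H S) = cas"
proof (intro ext)
  show "pre_digraph.cas (restrict_edges H S) u p v = cas u p v" for u p v
    by (induction p arbitrary: u) (simp_all add: pre_digraph.cas.simps)
qed

lemma awalk_restrict_edges_iff:
  "pre_digraph.awalk (restrict_edges H S) u p v \<longleftrightarrow> awalk u p v \<and> set p \<subseteq> \<Union>S"
  by (auto simp: pre_digraph.awalk_def arcs_UNIV)

lemma apath_restrict_edges_iff:
  "pre_digraph.apath (restrict_edges H S) u p v \<longleftrightarrow> apath u p v \<and> set p \<subseteq> \<Union>S"
  by (auto simp: pre_digraph.apath_def awalk_restrict_edges_iff)

lemma undirected_cycle_restrict_edges_iff: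
  "undirected_cycle M (restrict_edges H S) p \<longleftrightarrow>
     cycle p \<and> distinct (map (edge_of M) p) \<and> set p \<subseteq> \<Union>S"
  by (auto simp: undirected_cycle_def pre_digraph.cycle_def awalk_restrict_edges_iff)

lemma sum_potential_walk:
  fixes \<alpha> :: "'d set \<Rightarrow> real"
  assumes "awalk u p v"
  shows "(\<Sum>d\<leftarrow>p. \<alpha> (head H d) - \<alpha> (tail H d)) = \<alpha> v - \<alpha> u"
  using assms by (induction p arbitrary: u) (auto simp: awalk_simps)

lemma sum_potential_cycle:
  fixes \<alpha> :: "'d set \<Rightarrow> real"
  assumes "cycle p"
  shows "(\<Sum>d\<in>set p. \<alpha> (head H d) - \<alpha> (tail H d)) = 0"
proof -
  obtain u where "awalk u p u" "distinct p"
    using assms cycle_conv by blast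
  then show ?thesis
    using sum_potential_walk[of u p u \<alpha>] by (simp add: sum_list_distinct_conv_sum_set)
qed

text \<open>Summation by parts: skewness makes the tail terms repeat the head terms, which are then
  grouped by head. Circulations are thus orthogonal to potential differences.\<close>

lemma sum_mult_potential_difference:
  fixes \<alpha> :: "'d set \<Rightarrow> real" and x :: "'d \<Rightarrow> real"
  assumes "\<And>d. x (reversal M d) = - x d"
  shows "(\<Sum>d\<in>UNIV. x d * (\<alpha> (head H d) - \<alpha> (tail H d))) =
    2 * (\<Sum>v\<in>range (head H). \<alpha> v * (\<Sum>d | head H d = v. x d))"
proof -
  have "(\<Sum>d\<in>UNIV. x d * (\<alpha> (head H d) - \<alpha> (tail H d))) = 2 * (\<Sum>d\<in>UNIV. \<alpha> (head H d) * x d)"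
    using sum_skew_part[of x "\<lambda>d. \<alpha> (head H d)", OF assms]
    by (simp add: tail_eq_head_reversal mult.commute)
  also have "(\<Sum>d\<in>UNIV. \<alpha> (head H d) * x d) =
      (\<Sum>v\<in>range (head H). \<Sum>d | d \<in> UNIV \<and> head H d = v. \<alpha> (head H d) * x d)"
    by (rule sum.group[symmetric]) auto
  also have "\<dots> = (\<Sum>v\<in>range (head H). \<alpha> v * (\<Sum>d | head H d = v. x d))"
    by (intro sum.cong refl) (simp add: sum_distrib_left)
  finally show ?thesis .
qed

text \<open>A second dart on the edge of \<open>x\<close> would lead back to the tail of
  \<open>x\<close>, which a simple path never revisits.\<close>

lemma distinct_edges_of_apath:
  assumes "apath u p v"
  shows "distinct (map (edge_of M) p)"
  using assms
proof (induction p arbitrary: u)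
  case (Cons x p)
  then have p: "apath (head H x) p v" and new: "tail H x \<notin> set (awalk_verts (head H x) p)"
    by (auto simp: apath_Cons_iff)
  have "edge_of M x \<noteq> edge_of M y" if "y \<in> set p" for y
  proof
    assume "edge_of M x = edge_of M y"
    then have "tail H x = tail H y \<or> tail H x = head H y"
      by (auto simp: edge_of_eq_iff tail_eq_head_reversal)
    moreover have "awalk (head H x) p v" using p by (simp add: apath_def)
    ultimately show False
      using new awalk_verts_arc1[OF that] awalk_verts_arc2[OF _ that] by metis
  qed
  then show ?case using Cons.IH[OF p] by auto
qed simp

text \<open>A simple path back from the head of \<open>d\<close> repeats no edge and avoids the new
  one, so \<open>d\<close> closes it up. For a loop \<open>d\<close> the path is empty.\<close>

lemma cycle_closing_edge:
  assumes S: "S \<subseteq> edges M" and new: "edge_of M d \<notin> S"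
    and reach: "head H d \<rightarrow>\<^sup>*\<^bsub>restrict_edges H S\<^esub> tail H d"
  shows "\<exists>p. undirected_cycle M (restrict_edges H (insert (edge_of M d) S)) p"
proof -
  obtain p where p: "apath (head H d) p (tail H d)" "set p \<subseteq> \<Union>S"
    using reach wf_digraph.reachable_apath[OF wf_restrict_edges]
    by (auto simp: apath_restrict_edges_iff)
  have "cycle (d # p)"
    using p(1) by (auto simp: cycle_def apath_def awalk_Cons_iff arcs_UNIV)
  moreover have "edge_of M d \<notin> edge_of M ` set p"
    using p(2) new mem_Union_edges_iff[OF S] by fastforce
  ultimately have "undirected_cycle M (restrict_edges H (insert (edge_of M d) S)) (d # p)"
    using p(2) distinct_edges_of_apath[OF p(1)]
    by (auto simp: undirected_cycle_restrict_edges_iff edge_of_eq)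
  then show ?thesis ..
qed

text \<open>Induction on the edges: a new edge of a forest joins two components, so shifting the
  potential by a constant on one of them corrects the value across that edge.\<close>

lemma forest_potential:
  fixes a :: "'d \<Rightarrow> real"
  assumes "S \<subseteq> edges M" and "\<nexists>p. undirected_cycle M (restrict_edges H S) p"
    and skew: "\<And>d. a (reversal M d) = - a d"
  shows "\<exists>\<alpha>. \<forall>d\<in>\<Union>S. a d = \<alpha> (head H d) - \<alpha> (tail H d)"
proof -
  have "finite S" by simp
  then show ?thesis using assms(1,2)
  proof (induction S)
    case (insert e S)
    then have S: "S \<subseteq> edges M" by simp
    have "\<nexists>p. undirected_cycle M (restrict_edges H S) p"
      using insert.prems(2) by (auto simp: undirected_cycle_restrict_edges_iff)
    then obtain \<alpha> where \<alpha>: "\<And>d. d \<in> \<Union>S \<Longrightarrow> a d = \<alpha> (head H d) - \<alpha> (tail H d)"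
      using insert.IH[OF S] by blast
    obtain d where e: "e = edge_of M d"
      using insert.prems(1) by (auto simp: edges_def)
    let ?R = "restrict_edges H S"
    interpret R: wf_digraph ?R by (rule wf_restrict_edges)
    define K where "K = {v. head H d \<rightarrow>\<^sup>*\<^bsub>?R\<^esub> v}"
    have "head H d \<in> K"
      unfolding K_def using arcs_UNIV by (auto intro: R.reachable_refl)
    moreover have "tail H d \<notin> K"
      using cycle_closing_edge[OF S] insert.hyps(2) insert.prems(2) e by (auto simp: K_def)
    moreover have step: "head H x \<in> K" if "x \<in> \<Union>S" "tail H x \<in> K" for x
    proof -
      have "tail H x \<rightarrow>\<^bsub>?R\<^esub> head H x"
        using that(1) R.dominatesI[of x "tail H x" "head H x"] by (simp add: arc_to_ends_def)
      then show ?thesis using that(2) R.reachable_adj_trans by (auto simp: K_def)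
    qed
    \<comment> \<open>\<open>S\<close> holds both darts of each of its edges, so none of them
      crosses the border of \<open>K\<close> and the shift on \<open>K\<close> leaves their values
      alone.\<close>
    moreover have "tail H x \<in> K" if "x \<in> \<Union>S" "head H x \<in> K" for x
      using step[of "reversal M x"] that mem_Union_edges_iff[OF S]
      by (simp add: tail_eq_head_reversal reversal_involution)
    moreover define t where "t = a d - (\<alpha> (head H d) - \<alpha> (tail H d))"
    ultimately have "a x = (\<alpha> (head H x) + (if head H x \<in> K then t else 0)) -
        (\<alpha> (tail H x) + (if tail H x \<in> K then t else 0))" if "x \<in> \<Union>(insert e S)" for x
      using that \<alpha>[of x] skew[of d]
      by (auto simp: e edge_of_eq tail_eq_head_reversal reversal_involution)
    then show ?case
      by (intro exI[of _ "\<lambda>v. \<alpha> v + (if v \<in> K then t else 0)"]) blast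
  qed simp
qed

text \<open>On its support such a circulation is a potential difference, hence orthogonal to itself.\<close>

lemma forest_circulation_eq_zero:
  fixes a :: "'d \<Rightarrow> real"
  assumes "S \<subseteq> edges M" and "\<nexists>p. undirected_cycle M (restrict_edges H S) p"
    and skew: "\<And>d. a (reversal M d) = - a d"
    and support: "\<And>d. d \<notin> \<Union>S \<Longrightarrow> a d = 0"
    and circulation: "\<And>v. (\<Sum>d | head H d = v. a d) = 0"
  shows "a d = 0"
proof -
  obtain \<alpha> where \<alpha>: "\<forall>d\<in>\<Union>S. a d = \<alpha> (head H d) - \<alpha> (tail H d)"
    using forest_potential[where a = a, OF assms(1,2) skew] by blast
  have "(\<Sum>d\<in>UNIV. a d * a d) = (\<Sum>d\<in>UNIV. a d * (\<alpha> (head H d) - \<alpha> (tail H d)))"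
  proof (rule sum.cong)
    show "a x * a x = a x * (\<alpha> (head H x) - \<alpha> (tail H x))" for x
      using \<alpha> support[of x] by (cases "x \<in> \<Union>S") auto
  qed simp
  also have "\<dots> = 0"
    unfolding sum_mult_potential_difference[where x = a, OF skew] by (simp add: circulation)
  finally show ?thesis
    by (simp add: sum_nonneg_eq_0_iff)
qed

end

section \<open>Vertices, faces and homology\<close>

context combinatorial_embedding
begin

lemma dart_digraph_primal: "dart_digraph M (primal M)"
  by unfold_locales (auto simp: primal_def reversal_involution)

lemma dart_digraph_dual: "dart_digraph M (dual M)"
  by unfold_locales (auto simp: dual_def reversal_involution)

lemma orbit_apply_rotation: "orbit (rotation M) (rotation M d) = orbit (rotation M) d"
  by (metis rotation_permutes finite permutation_permutes permutation_orbit_step)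

text \<open>\<open>reversal M (rotation M d)\<close> follows \<open>d\<close> on its face. Read
  backwards: the dual tail of \<open>rotation M d\<close> is the dual head of
  \<open>d\<close>.\<close>

lemma head_dual_reversal_rotation:
  "head (dual M) (reversal M (rotation M d)) = head (dual M) d"
proof -
  have "bij (reversal M \<circ> rotation M)"
    using bij_reversal rotation_permutes permutes_bij bij_comp by blast
  then have "permutation (reversal M \<circ> rotation M)"
    by (simp add: permutation)
  then show ?thesis
    using permutation_orbit_step[of "reversal M \<circ> rotation M" d] by (simp add: dual_def)
qed

text \<open>In rotation order the duals of the darts into a vertex form a closed walk, so the
  differences telescope. A face potential thus yields a primal circulation.\<close>

lemma face_potential_balanced:
  fixes \<alpha> :: "'d set \<Rightarrow> real"
  shows "(\<Sum>d | head (primal M) d = v. \<alpha> (head (dual M) d) - \<alpha> (tail (dual M) d)) = 0"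
proof -
  let ?A = "{d. head (primal M) d = v}"
  have "inj_on (rotation M) ?A"
    using rotation_permutes permutes_inj inj_on_subset by blast
  moreover have "rotation M ` ?A \<subseteq> ?A"
    by (auto simp: primal_def orbit_apply_rotation)
  ultimately have "bij_betw (rotation M) ?A ?A"
    by (simp add: bij_betw_def endo_inj_surj)
  then have "(\<Sum>d\<in>?A. \<alpha> (tail (dual M) d)) = (\<Sum>d\<in>?A. \<alpha> (tail (dual M) (rotation M d)))"
    by (rule sum.reindex_bij_betw[symmetric])
  also have "\<dots> = (\<Sum>d\<in>?A. \<alpha> (head (dual M) d))"
    using head_dual_reversal_rotation
    by (simp add: dart_digraph.tail_eq_head_reversal[OF dart_digraph_dual])
  finally show ?thesis by (simp add: sum_subtractf)
qed

lemma imbalance_eq: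
  "imbalance M f v = (\<Sum>d | head (primal M) d = v. f d - f (reversal M d))"
proof -
  have "bij_betw (reversal M) {d. head (primal M) d = v} {d. tail (primal M) d = v}"
    by (rule bij_betwI[where g = "reversal M"]) (auto simp: primal_def reversal_involution)
  then have "(\<Sum>d | tail (primal M) d = v. f d) =
      (\<Sum>d | head (primal M) d = v. f (reversal M d))"
    by (rule sum.reindex_bij_betw[symmetric])
  then show ?thesis by (simp add: imbalance_def sum_subtractf)
qed

text \<open>The list contains at most one dart of each edge, so the choice of the canonical dart
  cancels out.\<close>

lemma dart_signature_eq:
  assumes "distinct (map (edge_of M) (\<gamma> i))"
  shows "dart_signature M \<gamma> d i =
    of_bool (d \<in> set (\<gamma> i)) - of_bool (reversal M d \<in> set (\<gamma> i))"
proof -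
  have "\<not> (d \<in> set (\<gamma> i) \<and> reversal M d \<in> set (\<gamma> i))"
    using assms reversal_fixpoint_free[of d] edge_of_reversal[of d]
    unfolding distinct_map inj_on_def by metis
  moreover have "canonical M (edge_of M d) \<in> edge_of M d"
    by (rule canonical_in_edge) (simp add: edges_def)
  then have "canonical M (edge_of M d) = d \<or> canonical M (edge_of M d) = reversal M d"
    by (simp add: edge_of_eq)
  ultimately show ?thesis
    using reversal_fixpoint_free[of d]
    by (auto simp: dart_signature_def edge_signature_def reversal_involution)
qed

text \<open>Reindexing the negative half of the signature by the reversal turns the homology cost
  into the net flow across the cycle.\<close>

lemma sum_mult_dart_signature:
  fixes h :: "'d \<Rightarrow> real"
  assumes "distinct (map (edge_of M) (\<gamma> i))"
  shows "(\<Sum>d\<in>UNIV. h d * of_int (dart_signature M \<gamma> d i)) =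
    (\<Sum>d\<in>set (\<gamma> i). h d - h (reversal M d))"
proof -
  have "(\<Sum>d\<in>UNIV. h d * of_int (dart_signature M \<gamma> d i)) =
      (\<Sum>d\<in>UNIV. h d * of_bool (d \<in> set (\<gamma> i))) -
      (\<Sum>d\<in>UNIV. h d * of_bool (reversal M d \<in> set (\<gamma> i)))"
    by (simp add: dart_signature_eq[where \<gamma> = \<gamma> and i = i, OF assms] right_diff_distrib sum_subtractf)
  also have "(\<Sum>d\<in>UNIV. h d * of_bool (reversal M d \<in> set (\<gamma> i))) =
      (\<Sum>d\<in>UNIV. h (reversal M d) * of_bool (d \<in> set (\<gamma> i)))"
    using sum_reversal[of "\<lambda>d. h (reversal M d) * of_bool (d \<in> set (\<gamma> i))"]
    by (simp add: reversal_involution)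
  finally show ?thesis
    by (simp add: sum_subtractf sum.If_cases of_bool_def if_distrib cong: if_cong)
qed

text \<open>After subtracting a potential that matches \<open>a\<close> on the cotree, the \<open>i\<close>-th sum involves
  only the \<open>i\<close>-th leftover edge, so what remains is supported on the spanning tree.\<close>

lemma null_homologous_circulation_potential:
  fixes a :: "'d \<Rightarrow> real"
  assumes decomposition: "tree_cotree_decomposition M g T L C"
    and l: "bij_betw l {1..2 * g} L"
    and \<gamma>: "\<And>i. i \<in> {1..2 * g} \<Longrightarrow> is_fundamental_cycle M (dual M) C (l i) (\<gamma> i)"
    and skew: "\<And>d. a (reversal M d) = - a d"
    and circulation: "\<And>v. (\<Sum>d | head (primal M) d = v. a d) = 0"
    and homology: "\<And>i. i \<in> {1..2 * g} \<Longrightarrow> (\<Sum>d\<in>set (\<gamma> i). a d) = 0"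
  obtains \<alpha> where "\<And>d. a d = \<alpha> (head (dual M) d) - \<alpha> (tail (dual M) d)"
proof -
  interpret primal: dart_digraph M "primal M" by (rule dart_digraph_primal)
  interpret dual: dart_digraph M "dual M" by (rule dart_digraph_dual)
  have edges: "edges M = T \<union> L \<union> C"
    and T: "T \<subseteq> edges M" "\<nexists>p. undirected_cycle M (restrict_edges (primal M) T) p"
    and C: "C \<subseteq> edges M" "\<nexists>p. undirected_cycle M (restrict_edges (dual M) C) p"
    using decomposition by (auto simp: tree_cotree_decomposition_def is_spanning_tree_def)
  obtain \<alpha> where \<alpha>: "\<forall>d\<in>\<Union>C. a d = \<alpha> (head (dual M) d) - \<alpha> (tail (dual M) d)"
    using dual.forest_potential[where a = a, OF C skew] by blast
  define b where "b d = a d - (\<alpha> (head (dual M) d) - \<alpha> (tail (dual M) d))" for d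
  have b_skew: "b (reversal M d) = - b d" for d
    by (simp add: b_def skew dual.tail_eq_head_reversal reversal_involution)
  have b_C: "b d = 0" if "edge_of M d \<in> C" for d
    using that \<alpha> mem_Union_edges_iff[OF C(1), of d] by (auto simp: b_def)
  have b_L: "b d = 0" if leftover: "edge_of M d \<in> L" for d
  proof -
    obtain i where i: "i \<in> {1..2 * g}" and e: "edge_of M d = l i"
      using bij_betw_imp_surj_on[OF l] leftover by auto
    note \<gamma>_i = \<gamma>[OF i, unfolded is_fundamental_cycle_def dual.undirected_cycle_restrict_edges_iff]
    then obtain x where x: "x \<in> set (\<gamma> i)" "edge_of M x = edge_of M d"
      using e by auto
    \<comment> \<open>The cycle uses each edge once, so apart from \<open>x\<close> all of its darts
      lie on cotree edges, where \<open>b\<close> vanishes.\<close>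
    have "b y = 0" if "y \<in> set (\<gamma> i)" "y \<noteq> x" for y
    proof (rule b_C)
      have "insert (l i) C \<subseteq> edges M"
        using C(1) leftover edges e by auto
      then have "edge_of M y \<in> insert (edge_of M d) C"
        using \<gamma>_i that(1) mem_Union_edges_iff e by (metis subsetD)
      moreover have "edge_of M y \<noteq> edge_of M x"
        using \<gamma>_i that x(1) by (auto simp: distinct_map inj_on_def)
      ultimately show "edge_of M y \<in> C" using x(2) by simp
    qed
    then have "(\<Sum>y\<in>set (\<gamma> i). b y) = b x"
      using x(1) by (simp add: sum.remove)
    \<comment> \<open>Subtracting a potential does not change the sum around a closed dual
      walk.\<close>
    moreover have "(\<Sum>y\<in>set (\<gamma> i). b y) = 0"
      using homology[OF i] dual.sum_potential_cycle[of "\<gamma> i" \<alpha>] \<gamma>_i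
      by (simp add: b_def sum_subtractf)
    ultimately have "b x = 0" by simp
    then show ?thesis
      using x(2) b_skew by (auto simp: edge_of_eq_iff)
  qed
  have "b d = 0" for d
  proof (rule primal.forest_circulation_eq_zero[where a = b, OF T b_skew])
    show "b x = 0" if "x \<notin> \<Union>T" for x
    proof -
      have "edge_of M x \<notin> T" using that mem_Union_edges_iff[OF T(1)] by blast
      then have "edge_of M x \<in> L \<union> C" using edges by (auto simp: edges_def)
      then show ?thesis using b_C b_L by blast
    qed
    show "(\<Sum>x | head (primal M) x = v. b x) = 0" for v
      using circulation[of v] face_potential_balanced[of \<alpha> v] by (simp add: b_def sum_subtractf)
  qed
  then show thesis
    using that[of \<alpha>] by (simp add: b_def)
qed

end

section \<open>Lexicographic costs and exchange between two optima\<close>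

text \<open>Neither first entry may be below that of \<open>xs\<close>, yet they average to it.
  Hence both agree with it and the comparison passes to the tails.\<close>

lemma list_eq_of_le_reflections:
  fixes xs ys zs :: "real list"
  assumes "length ys = length xs" "length zs = length xs" "xs \<le> ys" "xs \<le> zs"
    and "\<And>i. i < length xs \<Longrightarrow> ys ! i + zs ! i = 2 * xs ! i"
  shows "ys = xs"
  using assms
proof (induction xs arbitrary: ys zs)
  case (Cons x xs)
  obtain y ys' z zs' where eqs: "ys = y # ys'" "zs = z # zs'"
    using Cons.prems(1,2) by (metis length_Suc_conv length_Cons)
  have "y + z = 2 * x"
    using Cons.prems(5)[of 0] eqs by simp
  then have "y = x" "z = x"
    using Cons.prems(3,4) eqs by auto
  moreover have "ys' ! i + zs' ! i = 2 * xs ! i" if "i < length xs" for i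
    using Cons.prems(5)[of "Suc i"] that eqs by simp
  ultimately have "ys' = xs"
    using Cons.prems(1-4) eqs by (intro Cons.IH[of ys' zs']) auto
  then show ?case using eqs \<open>y = x\<close> by simp
qed simp

lemma imbalance_add: "imbalance M (\<lambda>d. f d + f' d) v = imbalance M f v + imbalance M f' v"
  by (simp add: imbalance_def sum.distrib)

lemma imbalance_diff: "imbalance M (\<lambda>d. f d - f' d) v = imbalance M f v - imbalance M f' v"
  by (simp add: imbalance_def sum_subtractf)

text \<open>Exposes the unperturbed cost as the coordinate that decides a lexicographic comparison
  first.\<close>

lemma vector_flow_cost_eq_Cons:
  "vector_flow_cost g (holiest_cost M g \<gamma> z c) f =
     flow_cost c f # tl (vector_flow_cost g (holiest_cost M g \<gamma> z c) f)"
  by (simp add: vector_flow_cost_def flow_cost_def holiest_cost_def upt_rec[of 0] map_tl del: upt_Suc)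

lemma holiest_cost_nth_1: "holiest_cost M g \<gamma> z c d ! 1 = 1"
  by (simp add: holiest_cost_def)

text \<open>Positions 0 and 1 hold \<open>c d\<close> and 1, while the cycles are numbered from 1;
  hence the shift by one.\<close>

lemma holiest_cost_nth_Suc:
  assumes "i \<in> {1..2 * g}"
  shows "holiest_cost M g \<gamma> z c d ! Suc i = of_int (dart_signature M \<gamma> d i)"
  using assms by (cases i) (auto simp: holiest_cost_def nth_append simp del: upt_Suc)

lemma holiest_cost_nth_last: "holiest_cost M g \<gamma> z c d ! (2 * g + 2) = z d"
  by (simp add: holiest_cost_def nth_append del: upt_Suc)

text \<open>Moving by \<open>t * (f - f')\<close> forward from \<open>f'\<close> and backward from \<open>f\<close> keeps both flows
  feasible and changes their common optimal cost by opposite amounts.\<close>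

lemma conformal_circulation_cost_eq_zero:
  fixes M :: "'d::finite embedding" and f f' :: "'d \<Rightarrow> real"
  assumes min: "min_cost_feasible_flow M (vector_flow_cost g c') \<mu> b f"
      "min_cost_feasible_flow M (vector_flow_cost g c') \<mu> b f'"
    and t: "\<And>d. 0 \<le> t d \<and> t d \<le> 1"
    and circulation: "\<And>v. imbalance M (\<lambda>d. t d * (f d - f' d)) v = 0"
    and k: "k < 2 * g + 3"
  shows "(\<Sum>d\<in>UNIV. t d * (f d - f' d) * c' d ! k) = 0"
proof -
  let ?cost = "vector_flow_cost g c'"
  define u where "u d = t d * (f d - f' d)" for d
  have feasible: "feasible_flow M \<mu> b f" "feasible_flow M \<mu> b f'"
    using min by (auto simp: min_cost_feasible_flow_def)
  \<comment> \<open>Both moved flows are dartwise convex combinations of \<open>f\<close> and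
    \<open>f'\<close>, so they respect the capacities.\<close>
  have between: "0 \<le> (1 - s) * x + s * y \<and> (1 - s) * x + s * y \<le> m"
    if "0 \<le> s \<and> s \<le> 1" "0 \<le> x \<and> x \<le> m" "0 \<le> y \<and> y \<le> m" for s x y m :: real
    using that convex_bound_le[of x m y "1 - s" s] by simp
  have "feasible_flow M \<mu> b (\<lambda>d. f' d + u d)"
    unfolding feasible_flow_def
  proof (intro conjI allI ballI)
    show "0 \<le> f' d + u d" "f' d + u d \<le> \<mu> d" for d
      using between[of "t d" "f' d" "\<mu> d" "f d"] t[of d] feasible
      by (auto simp: feasible_flow_def u_def algebra_simps)
    show "imbalance M (\<lambda>d. f' d + u d) v = b v" if "v \<in> verts (primal M)" for v
      using that feasible circulation[of v] by (simp add: imbalance_add feasible_flow_def u_def)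
  qed
  moreover have "feasible_flow M \<mu> b (\<lambda>d. f d - u d)"
    unfolding feasible_flow_def
  proof (intro conjI allI ballI)
    show "0 \<le> f d - u d" "f d - u d \<le> \<mu> d" for d
      using between[of "t d" "f d" "\<mu> d" "f' d"] t[of d] feasible
      by (auto simp: feasible_flow_def u_def algebra_simps)
    show "imbalance M (\<lambda>d. f d - u d) v = b v" if "v \<in> verts (primal M)" for v
      using that feasible circulation[of v] by (simp add: imbalance_diff feasible_flow_def u_def)
  qed
  \<comment> \<open>Two minima of a linear order coincide. This gives the two moves, which start at
    different flows, a common midpoint in cost.\<close>
  moreover have cost_eq: "?cost f = ?cost f'"
    using min by (auto simp: min_cost_feasible_flow_def intro: antisym)
  ultimately have "?cost f \<le> ?cost (\<lambda>d. f' d + u d)" "?cost f \<le> ?cost (\<lambda>d. f d - u d)"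
    using min by (auto simp: min_cost_feasible_flow_def)
  moreover have "?cost (\<lambda>d. f' d + u d) ! i + ?cost (\<lambda>d. f d - u d) ! i = 2 * ?cost f ! i"
    if "i < 2 * g + 3" for i
  proof -
    have "?cost f ! i = ?cost f' ! i" using cost_eq by simp
    then show ?thesis
      using that
      by (simp add: vector_flow_cost_def distrib_right left_diff_distrib sum.distrib sum_subtractf
          del: upt_Suc)
  qed
  ultimately have "?cost (\<lambda>d. f' d + u d) = ?cost f"
    by (intro list_eq_of_le_reflections[where zs = "?cost (\<lambda>d. f d - u d)"])
      (auto simp: vector_flow_cost_def simp del: upt_Suc)
  then have "?cost (\<lambda>d. f' d + u d) ! k = ?cost f' ! k"
    using cost_eq by simp
  then show ?thesis
    using k by (simp add: vector_flow_cost_def distrib_right sum.distrib u_def del: upt_Suc)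
qed

section \<open>Uniqueness of the optimal flow\<close>

locale holiest_costs = combinatorial_embedding M for M :: "'d::finite embedding" +
  fixes g :: nat and T L C :: "'d set set" and l :: "nat \<Rightarrow> 'd set" and \<gamma> :: "nat \<Rightarrow> 'd list"
    and r :: "'d set" and z c :: "'d \<Rightarrow> real"
  assumes decomposition: "tree_cotree_decomposition M g T L C"
    and bij_l: "bij_betw l {1..2 * g} L"
    and fundamental: "i \<in> {1..2 * g} \<Longrightarrow> is_fundamental_cycle M (dual M) C (l i) (\<gamma> i)"
    and drainage: "drainage M r z"
begin

abbreviation optimal :: "('d \<Rightarrow> real) \<Rightarrow> ('d set \<Rightarrow> real) \<Rightarrow> ('d \<Rightarrow> real) \<Rightarrow> bool" where
  "optimal \<equiv> min_cost_feasible_flow M (vector_flow_cost g (holiest_cost M g \<gamma> z c))"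

text \<open>Were both differences of the same strict sign, an equal amount \<open>w\<close> could be
  moved on both darts. This is a circulation, and the constant coordinate 1 gives it the nonzero
  cost \<open>2 * w\<close>.\<close>

lemma opposite_darts_differences:
  assumes "optimal \<mu> b f" "optimal \<mu> b f'"
  shows "(f d - f' d) * (f (reversal M d) - f' (reversal M d)) \<le> 0"
proof (rule ccontr)
  define h where "h x = f x - f' x" for x
  let ?d' = "reversal M d"
  assume "\<not> ?thesis"
  then have pos: "h d * h ?d' > 0" by (simp add: h_def)
  then have same_sign: "(0 < h d \<and> 0 < h ?d') \<or> (h d < 0 \<and> h ?d' < 0)"
    by (simp add: zero_less_mult_iff)
  \<comment> \<open>The weights make \<open>t * h\<close> equal on the two darts; the common sign
    keeps them between 0 and 1.\<close>
  define t where "t x = (if x = d then h ?d' / (h d + h ?d')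
    else if x = ?d' then h d / (h d + h ?d') else 0)" for x
  have t: "0 \<le> t x \<and> t x \<le> 1" for x
    using same_sign by (auto simp: t_def divide_simps)
  define w where "w = h d * h ?d' / (h d + h ?d')"
  have "w \<noteq> 0" using same_sign by (auto simp: w_def)
  have th: "t x * h x = (if x \<in> {d, ?d'} then w else 0)" for x
    by (auto simp: t_def w_def)
  have "x \<in> {d, ?d'} \<longleftrightarrow> reversal M x \<in> {d, ?d'}" for x
    using reversal_involution by (metis insert_iff singletonD)
  then have "imbalance M (\<lambda>x. t x * h x) v = 0" for v
    unfolding imbalance_eq th by simp
  then have "(\<Sum>x\<in>UNIV. t x * h x * holiest_cost M g \<gamma> z c x ! 1) = 0"
    using conformal_circulation_cost_eq_zero[where t = t and k = 1, OF assms, folded h_def, OF t]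
    by simp
  then have "(\<Sum>x\<in>UNIV. if x \<in> {d, ?d'} then w else 0) = 0"
    unfolding holiest_cost_nth_1 th by simp
  then have "(\<Sum>x\<in>{d, ?d'}. w) = 0"
    by (simp only: sum.inter_restrict[symmetric] finite Int_UNIV_left)
  then show False
    using \<open>w \<noteq> 0\<close> reversal_fixpoint_free[of d, symmetric] by simp
qed

text \<open>With weight 1 on every dart, the homology coordinates say that the net flow sums to zero
  around each fundamental cycle.\<close>

lemma optimal_difference_potential:
  assumes "optimal \<mu> b f" "optimal \<mu> b f'"
  obtains \<alpha> where "\<alpha> r = 0"
    "\<And>d. (f d - f' d) - (f (reversal M d) - f' (reversal M d)) =
       \<alpha> (head (dual M) d) - \<alpha> (tail (dual M) d)"
proof -
  interpret dual: dart_digraph M "dual M" by (rule dart_digraph_dual)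
  define h where "h x = f x - f' x" for x
  define a where "a x = h x - h (reversal M x)" for x
  have skew: "a (reversal M x) = - a x" for x
    by (simp add: a_def reversal_involution)
  have imbalance_zero: "imbalance M h v = 0" for v
  proof (cases "v \<in> verts (primal M)")
    case True
    then have "imbalance M f v = b v" "imbalance M f' v = b v"
      using assms by (auto simp: min_cost_feasible_flow_def feasible_flow_def)
    then show ?thesis
      unfolding h_def imbalance_diff by simp
  next
    case False
    then have empty: "{d. head (primal M) d = v} = {}"
      by (auto simp: primal_def)
    show ?thesis unfolding imbalance_eq empty by simp
  qed
  have circulation: "(\<Sum>d | head (primal M) d = v. a d) = 0" for v
    using imbalance_zero[of v] by (simp add: imbalance_eq a_def)
  have homology: "(\<Sum>d\<in>set (\<gamma> i). a d) = 0" if i: "i \<in> {1..2 * g}" for i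
  proof -
    have "distinct (map (edge_of M) (\<gamma> i))"
      using fundamental[OF i] by (simp add: is_fundamental_cycle_def undirected_cycle_def)
    then have "(\<Sum>d\<in>set (\<gamma> i). a d) = (\<Sum>d\<in>UNIV. h d * of_int (dart_signature M \<gamma> d i))"
      by (simp add: sum_mult_dart_signature[where \<gamma> = \<gamma> and i = i] a_def)
    also have "\<dots> = 0"
      using conformal_circulation_cost_eq_zero[where t = "\<lambda>_. 1" and k = "Suc i",
          OF assms, folded h_def] imbalance_zero i
      by (simp add: holiest_cost_nth_Suc)
    finally show ?thesis .
  qed
  obtain \<alpha> where "\<And>d. a d = \<alpha> (head (dual M) d) - \<alpha> (tail (dual M) d)"
    using null_homologous_circulation_potential[where a = a,
        OF decomposition bij_l fundamental skew circulation homology] by blast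
  \<comment> \<open>Only differences matter, so the potential can be shifted to vanish at the sink,
    the one face where the drainage prescribes no sign.\<close>
  then show thesis
    using that[of "\<lambda>\<phi>. \<alpha> \<phi> - \<alpha> r"] by (simp add: a_def h_def)
qed

text \<open>The positive part of the potential induces a conformal circulation; its drainage cost is a
  sum of nonpositive terms.\<close>

lemma optimal_difference_potential_nonpos:
  assumes optimal: "optimal \<mu> b f" "optimal \<mu> b f'"
    and \<alpha>: "\<alpha> r = 0"
      "\<And>d. (f d - f' d) - (f (reversal M d) - f' (reversal M d)) =
         \<alpha> (head (dual M) d) - \<alpha> (tail (dual M) d)"
    and \<phi>: "\<phi> \<in> verts (dual M)"
  shows "\<alpha> \<phi> \<le> 0"
proof -
  interpret dual: dart_digraph M "dual M" by (rule dart_digraph_dual)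
  define h where "h x = f x - f' x" for x
  define \<beta> where "\<beta> \<psi> = max (\<alpha> \<psi>) 0" for \<psi>
  define \<Delta> where "\<Delta> \<xi> x = (\<xi> (head (dual M) x) - \<xi> (tail (dual M) x) :: real)" for \<xi> x
  have \<Delta>_reversal: "\<Delta> \<xi> (reversal M x) = - \<Delta> \<xi> x" for \<xi> x
    by (simp add: \<Delta>_def dual.tail_eq_head_reversal reversal_involution)
  have h: "h x - h (reversal M x) = \<Delta> \<alpha> x" for x
    using \<alpha>(2) by (simp add: h_def \<Delta>_def)
  \<comment> \<open>Taking positive parts is monotone and does not increase distances, so the
    quotient lies between 0 and 1. Where \<open>\<Delta> \<alpha> x\<close> is 0 the quotient is 0
    by convention, and \<open>\<Delta> \<beta> x\<close> is 0 too.\<close>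
  define t where "t x = \<Delta> \<beta> x / \<Delta> \<alpha> x" for x
  have t: "0 \<le> t x \<and> t x \<le> 1" for x
    by (auto simp: t_def \<Delta>_def \<beta>_def max_def divide_simps)
  \<comment> \<open>Both darts of an edge are scaled alike, so scaling the flow by \<open>t\<close>
    scales its net flow by \<open>t\<close> as well.\<close>
  have t_reversal: "t (reversal M x) = t x" for x
    by (simp add: t_def \<Delta>_reversal)
  have "\<Delta> \<beta> x = 0" if "\<Delta> \<alpha> x = 0" for x
    using that by (simp add: \<Delta>_def \<beta>_def)
  then have "t x * (h x - h (reversal M x)) = \<Delta> \<beta> x" for x
    by (simp add: h t_def)
  then have th: "t x * h x - t (reversal M x) * h (reversal M x) = \<Delta> \<beta> x" for x
    by (simp add: t_reversal right_diff_distrib)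
  have "imbalance M (\<lambda>x. t x * h x) v = 0" for v
    unfolding imbalance_eq th \<Delta>_def by (rule face_potential_balanced)
  then have "(\<Sum>x\<in>UNIV. t x * h x * z x) = 0"
    using conformal_circulation_cost_eq_zero[where t = t and k = "2 * g + 2", OF optimal, folded h_def, OF t]
    unfolding holiest_cost_nth_last by simp
  moreover have z: "z (reversal M x) = - z x" for x
    using drainage by (simp add: drainage_def dual_flow_def)
  ultimately have "(\<Sum>x\<in>UNIV. z x * \<Delta> \<beta> x) = 0"
    using sum_skew_part[of z "\<lambda>x. t x * h x"] unfolding th[symmetric]
    by (simp add: mult.commute)
  \<comment> \<open>Summation by parts over the faces.\<close>
  then have "(\<Sum>\<psi>\<in>verts (dual M). \<beta> \<psi> * dual_imbalance M z \<psi>) = 0"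
    using dual.sum_mult_potential_difference[of z \<beta>] z
    by (simp add: \<Delta>_def dual_imbalance_def) (simp add: dual_def)
  moreover have nonpos: "\<beta> \<psi> * dual_imbalance M z \<psi> \<le> 0" if "\<psi> \<in> verts (dual M)" for \<psi>
    using drainage that \<alpha>(1)
    by (cases "\<psi> = r") (auto simp: drainage_def \<beta>_def mult_le_0_iff less_imp_le)
  ultimately have "\<beta> \<phi> * dual_imbalance M z \<phi> = 0"
    using \<phi> sum_nonneg_eq_0_iff[of "verts (dual M)" "\<lambda>\<psi>. - (\<beta> \<psi> * dual_imbalance M z \<psi>)"]
    by (simp add: sum_negf)
  moreover have "dual_imbalance M z \<phi> < 0" if "\<phi> \<noteq> r"
    using drainage \<phi> that by (simp add: drainage_def)
  ultimately have "\<beta> \<phi> = 0"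
    using \<alpha>(1) by (cases "\<phi> = r") (auto simp: \<beta>_def)
  then show ?thesis by (simp add: \<beta>_def max_def split: if_splits)
qed

lemma optimal_unique:
  assumes optimal: "optimal \<mu> b f" "optimal \<mu> b f'"
  shows "f = f'"
proof
  fix d
  interpret dual: dart_digraph M "dual M" by (rule dart_digraph_dual)
  obtain \<alpha> where \<alpha>: "\<alpha> r = 0"
    "\<And>d. (f d - f' d) - (f (reversal M d) - f' (reversal M d)) =
       \<alpha> (head (dual M) d) - \<alpha> (tail (dual M) d)"
    using optimal_difference_potential[OF optimal] by blast
  have "\<alpha> \<phi> = 0" if "\<phi> \<in> verts (dual M)" for \<phi>
  proof (rule antisym)
    show "\<alpha> \<phi> \<le> 0"
      using optimal_difference_potential_nonpos[OF optimal \<alpha> that] .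
    \<comment> \<open>Exchanging the two flows negates the potential.\<close>
    have "- \<alpha> \<phi> \<le> 0"
      using \<alpha> that
      by (intro optimal_difference_potential_nonpos[OF optimal(2,1), where \<alpha> = "\<lambda>\<phi>. - \<alpha> \<phi>"])
        (auto simp: algebra_simps)
    then show "0 \<le> \<alpha> \<phi>" by simp
  qed
  then have "f d - f' d = f (reversal M d) - f' (reversal M d)"
    using \<alpha>(2)[of d] dual.head_in_verts[of d] dual.tail_in_verts[of d] by (simp add: dual.arcs_UNIV)
  \<comment> \<open>Equal differences on the two darts make their product a square, while that
    product is at most 0.\<close>
  then have "(f d - f' d)\<^sup>2 \<le> 0"
    using opposite_darts_differences[OF optimal, of d] by (simp add: power2_eq_square)
  then show "f d = f' d"
    by simp
qed

end

theorem theorem5: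
  fixes M :: "'d::finite embedding"
    and g :: nat
    and c :: "'d \<Rightarrow> real"
    and c' :: "'d \<Rightarrow> real list"
    and \<mu> :: "'d \<Rightarrow> real"
    and b :: "'d set \<Rightarrow> real"
  assumes "combinatorial_embedding M"
    and "Digraph_Component.connected (primal M)"
    and "has_genus M g"
    and "holiest_perturbation M g c c'"
    and "\<And>d. 0 \<le> \<mu> d"
    and "\<exists>f. min_cost_feasible_flow M (vector_flow_cost g c') \<mu> b f"
  shows "(\<exists>!f. min_cost_feasible_flow M (vector_flow_cost g c') \<mu> b f) \<and>
    (\<forall>f. min_cost_feasible_flow M (vector_flow_cost g c') \<mu> b f \<longrightarrow>
         min_cost_feasible_flow M (flow_cost c) \<mu> b f)"
proof -
  obtain T L C l \<gamma> r z where "tree_cotree_decomposition M g T L C" "bij_betw l {1..2 * g} L"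
    "\<forall>i \<in> {1..2 * g}. is_fundamental_cycle M (dual M) C (l i) (\<gamma> i)" "drainage M r z"
    and c': "c' = holiest_cost M g \<gamma> z c"
    using assms(4) unfolding holiest_perturbation_def by blast
  then interpret holiest_costs M g T L C l \<gamma> r z c
    using assms(1) by (simp add: holiest_costs_def holiest_costs_axioms_def)
  have "flow_cost c f \<le> flow_cost c f'"
    if "vector_flow_cost g c' f \<le> vector_flow_cost g c' f'" for f f'
    using that vector_flow_cost_eq_Cons[of g M \<gamma> z c] Cons_le_Cons
    unfolding c' by (metis less_imp_le order_refl)
  then have "min_cost_feasible_flow M (flow_cost c) \<mu> b f"
    if "min_cost_feasible_flow M (vector_flow_cost g c') \<mu> b f" for f
    using that unfolding min_cost_feasible_flow_def by blast
  moreover have "f = f'" if "min_cost_feasible_flow M (vector_flow_cost g c') \<mu> b f"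
    "min_cost_feasible_flow M (vector_flow_cost g c') \<mu> b f'" for f f'
    using optimal_unique that unfolding c' by blast
  ultimately show ?thesis using assms(6) by blast
qed

end
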